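(* Let $X$ be a countable regular $q^+$ space with analytic topology, and let $Y$ be a countable regular space with a countable base. Then $X\times Y$ is a $q^+$ space.
   Context: A topological space $X$ is a $q^+$ space if for all $A\subseteq X$, all $x\in\overline{A}$ and every partition $(F_n)_n$ of $A$ into finite sets, there is $S\subseteq A$ such that $x\in\overline{S}$ and $S\cap F_n$ has at most one element for each $n$. A subset of a Polish space is analytic if it is a continuous image of a Polish space. A topology $\tau$ on a countable set $X$ is analytic if $\tau$ is an analytic subset of the Cantor cube $2^X=\{0,1\}^X$, where subsets of $X$ are identified with their characteristic functions. *)

theory Defs
  imports "HOL-Analysis.Analysis"
begin

text \<open>The pieces \<open>F n\<close> may be empty, so that finite and countably infinite partitions are both covered;
  spaces are not assumed to be \<open>T\<^sub>1\<close>.\<close>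

definition q_plus_space :: "'a topology \<Rightarrow> bool" where
  "q_plus_space X \<longleftrightarrow>
     (\<forall>A x. \<forall>F :: nat \<Rightarrow> 'a set.
        A \<subseteq> topspace X \<and> x \<in> X closure_of A \<and>
        (\<Union>n. F n) = A \<and> disjoint_family F \<and> (\<forall>n. finite (F n)) \<longrightarrow>
        (\<exists>S\<subseteq>A. x \<in> X closure_of S \<and> (\<forall>n. card (S \<inter> F n) \<le> 1)))"

definition Polish_topology :: "'a topology \<Rightarrow> bool" where
  "Polish_topology P \<longleftrightarrow> completely_metrizable_space P \<and> separable_space P"

text \<open>The existential quantifier cannot range over types, so the domain \<open>P\<close> is required to live on a subset
  of the type \<^typ>\<open>nat \<Rightarrow> real\<close> (with an arbitrary Polish topology). This is no restriction: every Polish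
  space is homeomorphic to a subspace of the countable power of the real line, so up to homeomorphism
  every Polish space occurs as some \<open>P\<close>. As \<open>P\<close> may be empty, the empty set is analytic. The notion is
  intended for a Polish ambient space \<open>Z\<close>.\<close>

definition analytic_in :: "'a topology \<Rightarrow> 'a set \<Rightarrow> bool" where
  "analytic_in Z A \<longleftrightarrow>
     A \<subseteq> topspace Z \<and>
     (\<exists>P :: (nat \<Rightarrow> real) topology. \<exists>f.
        Polish_topology P \<and> continuous_map P Z f \<and> f ` topspace P = A)"

definition Cantor_cube :: "'a set \<Rightarrow> ('a \<Rightarrow> bool) topology" where
  "Cantor_cube X = product_topology (\<lambda>_. discrete_topology (UNIV :: bool set)) X"

text \<open>The points of a product topology are extensional functions, hence the restriction.\<close>

definition char_fun :: "'a set \<Rightarrow> 'a set \<Rightarrow> ('a \<Rightarrow> bool)" where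
  "char_fun X U = (\<lambda>x\<in>X. x \<in> U)"

definition has_analytic_topology :: "'a topology \<Rightarrow> bool" where
  "has_analytic_topology X \<longleftrightarrow>
     analytic_in (Cantor_cube (topspace X)) (char_fun (topspace X) ` {U. openin X U})"

end

theory Submission
  imports Defs
begin

text \<open>
  Let \<open>(x, y)\<close> be in the closure of \<open>A\<close>, let \<open>F n\<close> be the finite pieces of \<open>A\<close>, and let \<open>V k\<close> be a countable
  base at \<open>y\<close>. For a fixed \<open>k\<close> the first coordinates of \<open>A \<inter> (X \<times> V k)\<close> accumulate at \<open>x\<close>, so the
  \<open>q\<^sup>+\<close> property of \<open>X\<close> gives a selector that works for \<open>V k\<close>. The difficulty is to make one selector
  out of these countably many: the union of selectors need not be a selector. It is one
  if the index set is first split into disjoint sets \<open>N k\<close> and the \<open>k\<close>-th selector is taken inside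
  \<open>\<Union>n\<in>N k. F n\<close>. So \<open>N k\<close> must be such that every neighbourhood \<open>U\<close> of \<open>x\<close> still meets
  the first coordinates of \<open>(\<Union>n\<in>N k. F n) \<inter> (X \<times> V k)\<close>; with \<open>G k n\<close> the set of first coordinates of
  \<open>F n \<inter> (X \<times> V k)\<close>, this says that \<open>N k\<close> is contained in none of the sets
  \<open>{n. U \<inter> G k n = {}}\<close>.

  If the neighbourhoods of \<open>x\<close> trace an ultrafilter on the projection of \<open>A\<close>, such a splitting may fail to
  exist, and this is where analyticity enters. As in the theorem of Jalali-Naini and Talagrand, the
  ideal generated by the sets \<open>{n. U \<inter> G k n = {}}\<close> is meager in the Cantor space
  (\<open>analytic_neighbourhoods_meager_or_cofinite_miss\<close>), and disjoint sets that are generic enough escape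
  countably many meager families at the same time (\<open>disjoint_sets_escaping_meager_families\<close>).

  Meagerness has a direct proof that bypasses the Baire property of analytic sets. If a
  continuous image of a Polish space were not meager, then, after removal of all open sets with a
  meager image, every remaining nonempty open set would have a somewhere dense image. Two points can then be built by alternating
  approximations such that their images together cover all but finitely many numbers
  (\<open>fusion_of_two_points\<close>). These two points give two neighbourhoods of \<open>x\<close> whose intersection misses almost
  all \<open>G k n\<close>. Then a neighbourhood of \<open>(x, y)\<close> meets \<open>A\<close> in a finite set, so some single point of \<open>A\<close> lies
  in all neighbourhoods of \<open>(x, y)\<close>, and this point alone is a selector.
\<close>

section \<open>Meager families of sets of natural numbers\<close>

text \<open>This says that the downward closure of \<open>\<E>\<close> is nowhere dense in the Cantor space. For a downward closed
  family it suffices to avoid finite patterns of ones: a finite pattern \<open>s\<close> on \<open>{..<n}\<close> is extended by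
  ones on \<open>{n..<m}\<close>, and no member of the family has this extension as its initial part.\<close>

definition nowhere_dense_family :: "nat set set \<Rightarrow> bool" where
  "nowhere_dense_family \<E> \<longleftrightarrow> (\<forall>n. \<exists>m. \<forall>E\<in>\<E>. \<not> {n..<m} \<subseteq> E)"

definition meager_family :: "nat set set \<Rightarrow> bool" where
  "meager_family \<E> \<longleftrightarrow>
     (\<exists>\<C>. countable \<C> \<and> (\<forall>\<D>\<in>\<C>. nowhere_dense_family \<D>) \<and> \<E> \<subseteq> \<Union>\<C>)"

lemma nowhere_dense_imp_meager_family:
  assumes "nowhere_dense_family \<E>"
  shows "meager_family \<E>"
  unfolding meager_family_def by (rule exI[of _ "{\<E>}"]) (simp add: assms)

lemma meager_family_subset: "meager_family \<D> \<Longrightarrow> \<E> \<subseteq> \<D> \<Longrightarrow> meager_family \<E>"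
  unfolding meager_family_def by (meson order_trans)

lemma meager_family_UN:
  assumes "countable I" "\<And>i. i \<in> I \<Longrightarrow> meager_family (\<E> i)"
  shows "meager_family (\<Union>i\<in>I. \<E> i)"
proof -
  obtain \<C> where \<C>: "\<And>i. i \<in> I \<Longrightarrow> countable (\<C> i) \<and> (\<forall>\<D>\<in>\<C> i. nowhere_dense_family \<D>) \<and> \<E> i \<subseteq> \<Union>(\<C> i)"
    using assms(2) unfolding meager_family_def by metis
  show ?thesis
    unfolding meager_family_def
  proof (intro exI[of _ "\<Union>i\<in>I. \<C> i"] conjI)
    show "countable (\<Union>i\<in>I. \<C> i)"
      using \<C> assms(1) by (intro countable_UN) auto
    show "\<forall>\<D>\<in>\<Union>i\<in>I. \<C> i. nowhere_dense_family \<D>"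
      using \<C> by blast
    show "(\<Union>i\<in>I. \<E> i) \<subseteq> \<Union>(\<Union>i\<in>I. \<C> i)"
      using \<C> by (fastforce dest: subsetD)
  qed
qed

lemma meager_family_Un:
  "meager_family \<D> \<Longrightarrow> meager_family \<E> \<Longrightarrow> meager_family (\<D> \<union> \<E>)"
  using meager_family_UN[of "{True, False}" "\<lambda>b. if b then \<D> else \<E>"] by (simp add: Un_commute)

lemma meager_family_enum:
  assumes "meager_family \<E>"
  obtains \<D> :: "nat \<Rightarrow> nat set set"
  where "\<And>j. nowhere_dense_family (\<D> j)" "\<E> \<subseteq> (\<Union>j. \<D> j)"
proof -
  obtain \<C> where \<C>: "countable \<C>" "\<forall>\<D>\<in>\<C>. nowhere_dense_family \<D>" "\<E> \<subseteq> \<Union>\<C>"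
    using assms unfolding meager_family_def by blast
  have "nowhere_dense_family {}"
    by (simp add: nowhere_dense_family_def)
  then have "\<forall>\<D>\<in>insert {} \<C>. nowhere_dense_family \<D>"
    using \<C>(2) by blast
  moreover have "range (from_nat_into (insert {} \<C>)) = insert {} \<C>"
    using \<C>(1) by (intro range_from_nat_into) auto
  ultimately show ?thesis
    using \<C>(3) by (intro that[of "from_nat_into (insert {} \<C>)"]) (metis rangeI, simp)
qed

text \<open>A finite-extension construction. Requirement \<open>(k, j)\<close> asks that \<open>N k\<close> escapes the \<open>j\<close>-th nowhere dense
  part of \<open>\<E> k\<close>, and a single interval placed inside \<open>N k\<close> fulfils it. Since the interval may start
  arbitrarily far to the right, the requirements can be served one after the other by
  consecutive intervals, and the sets \<open>N k\<close> come out disjoint.\<close>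

lemma disjoint_sets_escaping_meager_families:
  fixes \<E> :: "nat \<Rightarrow> nat set set"
  assumes "\<And>k. meager_family (\<E> k)"
  obtains N :: "nat \<Rightarrow> nat set"
  where "disjoint_family N" "\<And>k E. E \<in> \<E> k \<Longrightarrow> \<not> N k \<subseteq> E"
proof -
  have "\<exists>\<D> :: nat \<Rightarrow> nat set set. (\<forall>j. nowhere_dense_family (\<D> j)) \<and> \<E> k \<subseteq> (\<Union>j. \<D> j)" for k
    using meager_family_enum[OF assms] by metis
  then obtain \<D> :: "nat \<Rightarrow> nat \<Rightarrow> nat set set"
    where nwd: "\<And>k j. nowhere_dense_family (\<D> k j)" and cover: "\<And>k. \<E> k \<subseteq> (\<Union>j. \<D> k j)"
    by metis
  let ?\<D> = "\<lambda>i. \<D> (fst (prod_decode i)) (snd (prod_decode i))"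
  have "\<exists>m\<ge>n. \<forall>E\<in>?\<D> i. \<not> {n..<m} \<subseteq> E" for i n
  proof -
    obtain m where m: "\<forall>E\<in>?\<D> i. \<not> {n..<m} \<subseteq> E"
      using nwd unfolding nowhere_dense_family_def by blast
    have "{n..<max n m} = {n..<m}" by auto
    with m show ?thesis
      by (metis max.cobounded1)
  qed
  then have "\<forall>i n. \<exists>m. n \<le> m \<and> (\<forall>E\<in>?\<D> i. \<not> {n..<m} \<subseteq> E)"
    by blast
  then obtain next_end where next_end:
    "\<forall>i n. n \<le> next_end i n \<and> (\<forall>E\<in>?\<D> i. \<not> {n..<next_end i n} \<subseteq> E)"
    unfolding choice_iff by blast
  define b where "b = rec_nat 0 next_end"
  have b_Suc: "b (Suc i) = next_end i (b i)" for i
    by (simp add: b_def)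
  have mono: "b i \<le> b (Suc i)" for i
    using next_end b_Suc by simp
  have esc: "\<not> {b i..<b (Suc i)} \<subseteq> E" if "E \<in> ?\<D> i" for i E
    using next_end that b_Suc by simp
  have disj: "{b i..<b (Suc i)} \<inter> {b j..<b (Suc j)} = {}" if "i \<noteq> j" for i j
  proof -
    have "b (Suc i) \<le> b j" if "i < j" for i j
      using lift_Suc_mono_le[of b "Suc i" j] mono that by simp
    with \<open>i \<noteq> j\<close> show ?thesis
      by (cases "i < j") (force simp: not_less)+
  qed
  define N where "N k = (\<Union>j. {b (prod_encode (k, j))..<b (Suc (prod_encode (k, j)))})" for k
  show ?thesis
  proof
    show "disjoint_family N"
      unfolding disjoint_family_on_def
    proof (intro ballI impI)
      fix k k' :: nat assume "k \<noteq> k'"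
      then have "prod_encode (k, j) \<noteq> prod_encode (k', j')" for j j'
        by (simp add: prod_encode_eq)
      then show "N k \<inter> N k' = {}"
        unfolding N_def using disj by blast
    qed
    fix k E assume "E \<in> \<E> k"
    then obtain j where "E \<in> \<D> k j"
      using cover by blast
    then have "\<not> {b (prod_encode (k, j))..<b (Suc (prod_encode (k, j)))} \<subseteq> E"
      using esc[of E "prod_encode (k, j)"] by simp
    then show "\<not> N k \<subseteq> E"
      unfolding N_def by blast
  qed
qed

section \<open>Somewhere dense images of complete metric spaces\<close>

lemma (in Metric_space) separable_imp_second_countable_mtopology:
  assumes "separable_space mtopology"
  shows "second_countable mtopology"
proof -
  obtain D where D: "countable D" "D \<subseteq> M" "mtopology closure_of D = M"
    using assms unfolding separable_space_def by auto
  define \<B> where "\<B> = (\<lambda>(a, k). mball a (inverse (real (Suc k)))) ` (D \<times> UNIV)"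
  have "countable \<B>"
    using D(1) unfolding \<B>_def by auto
  moreover have "openin mtopology B" if "B \<in> \<B>" for B
    using that unfolding \<B>_def by auto
  moreover have "\<exists>B\<in>\<B>. x \<in> B \<and> B \<subseteq> U" if U: "openin mtopology U" and x: "x \<in> U" for U x
  proof -
    obtain r where r: "r > 0" "mball x r \<subseteq> U" and xM: "x \<in> M"
      using U x unfolding openin_mtopology by blast
    obtain k where k: "inverse (real (Suc k)) < r / 2"
      using reals_Archimedean[of "r / 2"] r(1) by auto
    have "x \<in> mtopology closure_of D" "x \<in> mball x (inverse (real (Suc k)))"
      using D(3) xM by simp_all
    then obtain a where a: "a \<in> D" "a \<in> mball x (inverse (real (Suc k)))"
      unfolding in_closure_of using openin_mball[of x] by blast
    have "mball a (inverse (real (Suc k))) \<subseteq> mball x r"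
    proof
      fix z assume z: "z \<in> mball a (inverse (real (Suc k)))"
      then have M: "x \<in> M" "a \<in> M" "z \<in> M"
        and "d x a < inverse (real (Suc k))" "d a z < inverse (real (Suc k))"
        using a by simp_all
      with k triangle[OF M] have "d x z < r"
        by linarith
      with M show "z \<in> mball x r"
        by simp
    qed
    moreover have "x \<in> mball a (inverse (real (Suc k)))"
      using a by (simp add: commute)
    moreover have "mball a (inverse (real (Suc k))) \<in> \<B>"
      unfolding \<B>_def by (rule image_eqI[of _ _ "(a, k)"]) (simp_all add: a(1))
    ultimately show ?thesis
      using r(2) by (meson order_trans)
  qed
  ultimately show ?thesis
    unfolding second_countable_def by (intro exI[of _ \<B>]) simp
qed

text \<open>If no nonempty relatively open set has a nowhere dense image, then every ball around a point of \<open>Q\<close>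
  has a number \<open>n\<close> such that each interval \<open>{n..<m}\<close> is contained in \<open>e p\<close> for some \<open>p\<close> in the ball, and by
  continuity for all \<open>p\<close> in a smaller ball. Two nested sequences of balls are built in turns: each time
  that one of them is shrunk, its points are made to cover the interval up to the
  number that belongs to the other one, while the new number is only bounded from below. In this way
  the gap opened by a step of one sequence is filled by the next step of the other. The limit points exist
  by completeness.\<close>

lemma (in Metric_space) fusion_of_two_points:
  fixes Q :: "'a set" and e :: "'a \<Rightarrow> nat set"
  assumes complete: "mcomplete" and closed: "closedin mtopology Q" and "Q \<noteq> {}"
    and op: "\<And>n. openin mtopology {p \<in> M. n \<in> e p}"
    and somewhere_dense:
      "\<And>W. openin mtopology W \<Longrightarrow> W \<inter> Q \<noteq> {} \<Longrightarrow> \<not> nowhere_dense_family (e ` (W \<inter> Q))"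
  obtains p q n where "p \<in> Q" "q \<in> Q" "{n..} \<subseteq> e p \<union> e q"
proof -
  have QM: "Q \<subseteq> M"
    using closed closedin_metric by blast
  \<comment> \<open>A triple consists of a centre, a radius and the number from which arbitrarily long intervals
    are available in the ball. In \<open>step k a m b\<close> the triple \<open>b\<close> refines \<open>a\<close>, and on the ball of \<open>b\<close> the
    interval up to \<open>m\<close> is already covered.\<close>
  define full where
    "full = (\<lambda>(c, r, n). c \<in> Q \<and> r > 0 \<and> (\<forall>m. \<exists>p \<in> mball c r \<inter> Q. {n..<m} \<subseteq> e p))"
  define step where
    "step k = (\<lambda>(c, r, n) m (c', r', n'). mcball c' r' \<subseteq> mball c r \<and> r' < inverse (real (Suc k)) \<and> m < n' \<and>
       (\<forall>p \<in> mcball c' r'. {n..<m} \<subseteq> e p))" for k :: nat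
  have full_small: "\<exists>r n. full (c, r, n) \<and> r < \<delta> \<and> m < n" if "c \<in> Q" "\<delta> > 0" for c \<delta> m
  proof -
    have r: "\<delta> / 2 > 0" and cM: "c \<in> M"
      using that QM by auto
    have "mball c (\<delta>/2) \<inter> Q \<noteq> {}"
      using r cM that(1) centre_in_mball_iff by blast
    then obtain n where n: "\<And>l. \<exists>p \<in> mball c (\<delta>/2) \<inter> Q. {n..<l} \<subseteq> e p"
      using somewhere_dense[of "mball c (\<delta>/2)"] unfolding nowhere_dense_family_def by auto
    have "\<exists>p \<in> mball c (\<delta>/2) \<inter> Q. {max n (Suc m)..<l} \<subseteq> e p" for l
    proof -
      have "{max n (Suc m)..<l} \<subseteq> {n..<l}" by auto
      with n[of l] show ?thesis by blast
    qed
    then have "full (c, \<delta>/2, max n (Suc m))"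
      unfolding full_def using r that by auto
    then show ?thesis
      using r by (intro exI[of _ "\<delta>/2"] exI[of _ "max n (Suc m)"]) auto
  qed
  have step_ex: "\<exists>b. full b \<and> step k a m b" if full_a: "full a" for a m k
  proof -
    obtain c r n where a: "a = (c, r, n)" by (cases a)
    obtain p where p: "p \<in> mball c r" "p \<in> Q" "{n..<m} \<subseteq> e p"
      using full_a unfolding full_def a by blast
    have "openin mtopology ((\<Inter>i\<in>{n..<m}. {p \<in> M. i \<in> e p}) \<inter> topspace mtopology)"
      by (rule openin_INT) (use op in auto)
    then have "openin mtopology (mball c r \<inter> ((\<Inter>i\<in>{n..<m}. {p \<in> M. i \<in> e p}) \<inter> M))"
      by (auto intro: openin_Int)
    moreover have "p \<in> mball c r \<inter> ((\<Inter>i\<in>{n..<m}. {p \<in> M. i \<in> e p}) \<inter> M)"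
      using p by auto
    ultimately obtain s where s: "s > 0"
      "mcball p s \<subseteq> mball c r \<inter> ((\<Inter>i\<in>{n..<m}. {p \<in> M. i \<in> e p}) \<inter> M)"
      unfolding openin_mtopology_mcball by meson
    obtain r' n' where b: "full (p, r', n')" "r' < min s (inverse (real (Suc k)))" "m < n'"
      using full_small[OF p(2), of "min s (inverse (real (Suc k)))" m] s(1) by auto
    have "mcball p r' \<subseteq> mcball p s"
      using b(2) by (intro mcball_subset_concentric) auto
    then have "step k a m (p, r', n')"
      unfolding step_def a using b(2,3) s(2) by auto
    with b(1) show ?thesis by blast
  qed
  let ?n = "\<lambda>(c, r, n). n"
  obtain c0 where c0: "c0 \<in> Q"
    using \<open>Q \<noteq> {}\<close> by blast
  obtain r0 n0 where a0: "full (c0, r0, n0)"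
    using full_small[OF c0, of 1 0] by auto
  \<comment> \<open>The two sequences of balls are interleaved into one: a state holds two consecutive triples, and the next
    triple refines the older one of them.\<close>
  have "\<exists>f. \<forall>i. (full (fst (f i)) \<and> full (snd (f i)) \<and> ?n (fst (f i)) \<le> ?n (snd (f i))) \<and>
     (fst (f (Suc i)) = snd (f i) \<and> step i (fst (f i)) (?n (snd (f i))) (snd (f (Suc i))))"
  proof (rule dependent_nat_choice[where P = "\<lambda>_ x. full (fst x) \<and> full (snd x) \<and> ?n (fst x) \<le> ?n (snd x)"
        and Q = "\<lambda>i x y. fst y = snd x \<and> step i (fst x) (?n (snd x)) (snd y)"])
    show "\<exists>x. full (fst x) \<and> full (snd x) \<and> ?n (fst x) \<le> ?n (snd x)"
      using a0 by (intro exI[of _ "((c0, r0, n0), (c0, r0, n0))"]) simp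
  next
    fix x i
    assume x: "full (fst x) \<and> full (snd x) \<and> ?n (fst x) \<le> ?n (snd x)"
    then obtain b where b: "full b" "step i (fst x) (?n (snd x)) b"
      using step_ex by blast
    then have "?n (snd x) \<le> ?n b"
      by (auto simp: step_def split: prod.splits)
    with b x show "\<exists>y. (full (fst y) \<and> full (snd y) \<and> ?n (fst y) \<le> ?n (snd y)) \<and>
      (fst y = snd x \<and> step i (fst x) (?n (snd x)) (snd y))"
      by (intro exI[of _ "(snd x, b)"]) simp
  qed
  then obtain f where f: "\<And>i. full (fst (f i))" "\<And>i. fst (f (Suc i)) = snd (f i)"
    "\<And>i. step i (fst (f i)) (?n (snd (f i))) (snd (f (Suc i)))"
    by blast
  define c where "c i = fst (fst (f i))" for i
  define r where "r i = fst (snd (fst (f i)))" for i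
  define N where "N i = snd (snd (fst (f i)))" for i
  have fst_f: "fst (f i) = (c i, r i, N i)" for i
    by (simp add: c_def r_def N_def)
  have full: "full (c i, r i, N i)" for i
    using f(1)[of i] by (simp add: fst_f)
  have step: "step i (c i, r i, N i) (N (Suc i)) (c (Suc (Suc i)), r (Suc (Suc i)), N (Suc (Suc i)))" for i
    using f(3)[of i] by (simp flip: f(2) add: fst_f)
  have cQ: "c i \<in> Q" "r i > 0" for i
    using full[of i] by (auto simp: full_def)
  \<comment> \<open>Triples two places apart have nested balls, so there is one limit for each parity \<open>s\<close>.\<close>
  have limit: "\<exists>p\<in>Q. \<forall>i. p \<in> mcball (c (2 * i + s)) (r (2 * i + s))" for s
  proof -
    let ?C = "\<lambda>i. mcball (c (2 * i + s)) (r (2 * i + s)) \<inter> Q"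
    have "\<Inter> (range ?C) \<noteq> {}"
    proof (rule complete[unfolded mcomplete_nest, rule_format], intro conjI allI impI)
      show "closedin mtopology (?C i)" for i
        using closed by auto
      show "?C i \<noteq> {}" for i
        using cQ[of "2 * i + s"] QM centre_in_mcball_iff less_imp_le by blast
      show "decseq ?C"
      proof (rule decseq_SucI)
        fix i
        have "mcball (c (2 * Suc i + s)) (r (2 * Suc i + s)) \<subseteq> mball (c (2 * i + s)) (r (2 * i + s))"
          using step[of "2 * i + s"] by (simp add: step_def)
        then show "?C (Suc i) \<subseteq> ?C i"
          using mball_subset_mcball by blast
      qed
      fix \<epsilon> :: real assume "\<epsilon> > 0"
      then obtain k where k: "inverse (real (Suc k)) < \<epsilon>"
        using reals_Archimedean by blast
      have "r (2 * Suc k + s) < inverse (real (Suc (2 * k + s)))"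
        using step[of "2 * k + s"] by (simp add: step_def)
      also have "\<dots> \<le> inverse (real (Suc k))"
        by (simp add: field_simps)
      finally have "r (2 * Suc k + s) \<le> \<epsilon>"
        using k by simp
      then show "\<exists>n a. ?C n \<subseteq> mcball a \<epsilon>"
        using mcball_subset_concentric by blast
    qed
    then show ?thesis by blast
  qed
  have block: "{N (2 * i + s)..<N (Suc (2 * i + s))} \<subseteq> e p"
    if "\<forall>i. p \<in> mcball (c (2 * i + s)) (r (2 * i + s))" for p i s
  proof -
    have "p \<in> mcball (c (Suc (Suc (2 * i + s)))) (r (Suc (Suc (2 * i + s))))"
      using that[rule_format, of "Suc i"] by simp
    then show ?thesis
      using step[of "2 * i + s"] by (simp add: step_def)
  qed
  obtain p where p: "p \<in> Q" "\<forall>i. p \<in> mcball (c (2 * i + 0)) (r (2 * i + 0))"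
    using limit by blast
  obtain q where q: "q \<in> Q" "\<forall>i. q \<in> mcball (c (2 * i + 1)) (r (2 * i + 1))"
    using limit by blast
  have N_less: "N (Suc i) < N (Suc (Suc i))" for i
    using step[of i] by (simp add: step_def)
  have "{N 1..} \<subseteq> e p \<union> e q"
  proof
    fix k assume k: "k \<in> {N 1..}"
    have grow: "i \<le> N (Suc i)" for i
    proof (induction i)
      case (Suc i)
      then show ?case using N_less[of i] by linarith
    qed simp
    have ex: "\<exists>j. k < N (Suc j)"
      using grow[of "Suc k"] by (intro exI[of _ "Suc k"]) simp
    define j where "j = (LEAST j. k < N (Suc j))"
    have j: "k < N (Suc j)"
      unfolding j_def using LeastI_ex[OF ex] .
    then have "j \<noteq> 0"
      using k by (cases j) auto
    then have "\<not> k < N j"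
      using not_less_Least[of "j - 1" "\<lambda>j. k < N (Suc j)"] unfolding j_def[symmetric] by simp
    with j have kj: "k \<in> {N j..<N (Suc j)}" by simp
    show "k \<in> e p \<union> e q"
    proof (cases "even j")
      case True
      then obtain i where "j = 2 * i + 0" by auto
      with kj block[OF p(2), of i] show ?thesis by auto
    next
      case False
      then obtain i where "j = 2 * i + 1" by (auto elim: oddE)
      with kj block[OF q(2), of i] show ?thesis by auto
    qed
  qed
  then show ?thesis
    using that p(1) q(1) by blast
qed

text \<open>Removing all basic open sets with a meager image leaves a closed set \<open>Q\<close>, and by separability only a
  meager part of the image is lost. If \<open>Q\<close> is empty, the whole image is meager. Otherwise an
  open set that meets \<open>Q\<close> cannot have a nowhere dense image on \<open>Q\<close>: its whole image would be meager, and a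
  basic set around a point of \<open>Q\<close> would have been removed. So the fusion applies to \<open>Q\<close>.\<close>

lemma (in Metric_space) meager_or_two_points_cover:
  fixes C :: "'a set" and e :: "'a \<Rightarrow> nat set"
  assumes complete: "mcomplete" and separable: "separable_space mtopology"
    and closed: "closedin mtopology C"
    and op: "\<And>n. openin mtopology {p \<in> M. n \<in> e p}"
  shows "meager_family (e ` C) \<or> (\<exists>p\<in>C. \<exists>q\<in>C. \<exists>n. {n..} \<subseteq> e p \<union> e q)"
proof (rule ccontr)
  assume neg: "\<not> ?thesis"
  obtain \<B> where \<B>: "countable \<B>" "\<And>B. B \<in> \<B> \<Longrightarrow> openin mtopology B"
    "\<And>U x. openin mtopology U \<Longrightarrow> x \<in> U \<Longrightarrow> \<exists>B\<in>\<B>. x \<in> B \<and> B \<subseteq> U"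
    using separable_imp_second_countable_mtopology[OF separable]
    unfolding second_countable_def by metis
  define \<R> where "\<R> = {B \<in> \<B>. meager_family (e ` (B \<inter> C))}"
  define Q where "Q = C - \<Union>\<R>"
  have R: "meager_family (e ` (\<Union>\<R> \<inter> C))"
  proof -
    have "countable \<R>"
      using \<B>(1) unfolding \<R>_def by auto
    then have "meager_family (\<Union>B\<in>\<R>. e ` (B \<inter> C))"
      by (rule meager_family_UN) (simp add: \<R>_def)
    then show ?thesis
      by (rule meager_family_subset) blast
  qed
  have nonempty: "Q \<noteq> {}"
  proof
    assume "Q = {}"
    then have "\<Union>\<R> \<inter> C = C" unfolding Q_def by blast
    with R neg show False by simp
  qed
  have Q_closed: "closedin mtopology Q"
    unfolding Q_def by (intro closedin_diff closed openin_Union) (auto simp: \<R>_def \<B>(2))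
  have dense: "\<not> nowhere_dense_family (e ` (W \<inter> Q))"
    if W: "openin mtopology W" "W \<inter> Q \<noteq> {}" for W
  proof
    assume nwd: "nowhere_dense_family (e ` (W \<inter> Q))"
    obtain x where x: "x \<in> W" "x \<in> Q" using W(2) by blast
    obtain B where B: "B \<in> \<B>" "x \<in> B" "B \<subseteq> W"
      using \<B>(3)[OF W(1) x(1)] by blast
    have "meager_family (e ` (W \<inter> Q) \<union> e ` (\<Union>\<R> \<inter> C))"
      by (intro meager_family_Un nowhere_dense_imp_meager_family nwd R)
    then have "meager_family (e ` (B \<inter> C))"
      by (rule meager_family_subset) (use B(3) in \<open>auto simp: Q_def\<close>)
    then have "x \<in> \<Union>\<R>"
      using B unfolding \<R>_def by blast
    with x(2) show False unfolding Q_def by blast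
  qed
  obtain p q n where pq: "p \<in> Q" "q \<in> Q" "{n..} \<subseteq> e p \<union> e q"
    by (rule fusion_of_two_points[OF complete Q_closed nonempty op dense])
  have "p \<in> C" "q \<in> C"
    using pq(1,2) by (simp_all add: Q_def)
  with pq(3) have ?thesis
    by (intro disjI2 bexI exI)
  with neg show False ..
qed

section \<open>Neighbourhoods in an analytic topology\<close>

text \<open>A version of the theorem of Jalali-Naini and Talagrand for the neighbourhood filter of \<open>x\<close>. The
  codes of the open sets that contain \<open>x\<close> form a clopen subset of the Polish space that
  parametrises the topology. Whether \<open>U \<inter> G n = {}\<close> depends on finitely many coordinates of
  the code of \<open>U\<close>, as \<open>G n\<close> is finite, and therefore the preceding dichotomy applies. In its second
  case, the two covering codes give open sets whose intersection misses almost all \<open>G n\<close>.\<close>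

lemma analytic_neighbourhoods_meager_or_cofinite_miss:
  fixes X :: "'a topology" and G :: "nat \<Rightarrow> 'a set"
  assumes "has_analytic_topology X" and "x \<in> topspace X"
    and fin: "\<And>n. finite (G n)" and sub: "\<And>n. G n \<subseteq> topspace X"
  shows "meager_family {{n. U \<inter> G n = {}} |U. openin X U \<and> x \<in> U} \<or>
    (\<exists>U n. openin X U \<and> x \<in> U \<and> (\<forall>m\<ge>n. U \<inter> G m = {}))"
proof -
  let ?T = "topspace X"
  obtain P :: "(nat \<Rightarrow> real) topology" and f
    where P: "Polish_topology P" and cont: "continuous_map P (Cantor_cube ?T) f"
      and img: "f ` topspace P = char_fun ?T ` {U. openin X U}"
    using assms(1) unfolding has_analytic_topology_def analytic_in_def by blast
  obtain M d where M: "Metric_space M d" "Metric_space.mcomplete M d"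
    and PM: "P = Metric_space.mtopology M d"
    using P unfolding Polish_topology_def completely_metrizable_space_def by blast
  interpret Metric_space M d by (fact M(1))
  have coord: "continuous_map P (discrete_topology UNIV) (\<lambda>p. f p a)" if "a \<in> ?T" for a
    using cont that unfolding Cantor_cube_def continuous_map_componentwise by blast
  have op: "openin mtopology {p \<in> M. f p a = b}" if "a \<in> ?T" for a b
    using openin_continuous_map_preimage[OF coord[OF that], of "{b}"] PM by simp
  define U where "U p = {a \<in> ?T. f p a}" for p
  have U_open: "openin X (U p)" if "p \<in> M" for p
  proof -
    obtain V where V: "openin X V" "f p = char_fun ?T V"
      using img \<open>p \<in> M\<close> PM by (metis (no_types, lifting) imageE image_eqI mem_Collect_eq topspace_mtopology)
    then have "U p = V"
      using openin_subset[OF V(1)] unfolding U_def char_fun_def by auto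
    with V(1) show ?thesis by simp
  qed
  have U_onto: "\<exists>p\<in>M. U p = V" if V: "openin X V" for V
  proof -
    obtain p where p: "p \<in> M" "f p = char_fun ?T V"
      using img V PM by (metis (no_types, lifting) imageE image_eqI mem_Collect_eq topspace_mtopology)
    then have "U p = V"
      using openin_subset[OF V] unfolding U_def char_fun_def by auto
    with p(1) show ?thesis by blast
  qed
  define C where "C = {p \<in> M. f p x}"
  define e where "e p = {n. U p \<inter> G n = {}}" for p
  have closed: "closedin mtopology C"
  proof -
    have "M - C = {p \<in> M. f p x = False}" unfolding C_def by auto
    then show ?thesis
      using op[OF assms(2), of False] unfolding closedin_def by (auto simp: C_def)
  qed
  have e_open: "openin mtopology {p \<in> M. n \<in> e p}" for n
  proof -
    have "openin mtopology {p \<in> M. \<not> f p a}" if "a \<in> G n" for a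
      using op[of a False] sub that by auto
    then have "openin mtopology ((\<Inter>a\<in>G n. {p \<in> M. \<not> f p a}) \<inter> topspace mtopology)"
      by (intro openin_INT fin)
    also have "(\<Inter>a\<in>G n. {p \<in> M. \<not> f p a}) \<inter> topspace mtopology = {p \<in> M. n \<in> e p}"
      using sub[of n] unfolding e_def U_def by auto
    finally show ?thesis .
  qed
  have CU: "p \<in> C \<longleftrightarrow> p \<in> M \<and> x \<in> U p" for p
    using assms(2) unfolding C_def U_def by auto
  consider "meager_family (e ` C)" | p q n where "p \<in> C" "q \<in> C" "{n..} \<subseteq> e p \<union> e q"
    using meager_or_two_points_cover[OF M(2) _ closed e_open] P PM unfolding Polish_topology_def by blast
  then show ?thesis
  proof cases
    case 1
    have "{{n. U \<inter> G n = {}} |U. openin X U \<and> x \<in> U} \<subseteq> e ` C"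
    proof clarify
      fix V assume "openin X V" "x \<in> V"
      then obtain p where "p \<in> M" "U p = V" using U_onto by blast
      then show "{n. V \<inter> G n = {}} \<in> e ` C"
        using \<open>x \<in> V\<close> CU unfolding e_def by blast
    qed
    then show ?thesis
      by (intro disjI1 meager_family_subset[OF 1])
  next
    case 2
    then have "openin X (U p \<inter> U q)" "x \<in> U p \<inter> U q"
      using U_open CU openin_Int by blast+
    moreover have "\<forall>m\<ge>n. (U p \<inter> U q) \<inter> G m = {}"
      using 2(3) unfolding e_def by blast
    ultimately show ?thesis
      by (intro disjI2 exI[of _ "U p \<inter> U q"] exI[of _ n]) simp
  qed
qed

section \<open>Selectors in the product\<close>

lemma point_neighbourhood_base_sequence:
  assumes "first_countable Y" "y \<in> topspace Y"
  obtains V :: "nat \<Rightarrow> 'b set"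
  where "\<And>k. openin Y (V k)" "\<And>k. y \<in> V k"
    "\<And>W. openin Y W \<Longrightarrow> y \<in> W \<Longrightarrow> \<exists>k. V k \<subseteq> W"
proof -
  obtain \<B> where \<B>: "countable \<B>" "\<And>V. V \<in> \<B> \<Longrightarrow> openin Y V"
    "\<And>U. openin Y U \<Longrightarrow> y \<in> U \<Longrightarrow> \<exists>V\<in>\<B>. y \<in> V \<and> V \<subseteq> U"
    using assms unfolding first_countable_def by metis
  let ?\<B> = "{V \<in> \<B>. y \<in> V}"
  have "?\<B> \<noteq> {}"
    using \<B>(3)[OF openin_topspace assms(2)] by blast
  then have "range (from_nat_into ?\<B>) = ?\<B>"
    using \<B>(1) by (intro range_from_nat_into) auto
  then obtain V :: "nat \<Rightarrow> 'b set" where V: "range V = ?\<B>" ..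
  show ?thesis
  proof
    have "V k \<in> ?\<B>" for k
      using V by (metis rangeI)
    then show "openin Y (V k)" "y \<in> V k" for k
      using \<B>(2) by auto
    fix W assume "openin Y W" "y \<in> W"
    then obtain B where "B \<in> ?\<B>" "B \<subseteq> W"
      using \<B>(3) by blast
    then show "\<exists>k. V k \<subseteq> W"
      using V by (metis imageE)
  qed
qed

lemma in_closure_of_prod_topology:
  "(x, y) \<in> prod_topology X Y closure_of S \<longleftrightarrow>
     x \<in> topspace X \<and> y \<in> topspace Y \<and>
     (\<forall>U V. openin X U \<and> x \<in> U \<and> openin Y V \<and> y \<in> V \<longrightarrow> S \<inter> (U \<times> V) \<noteq> {})"
  (is "?L \<longleftrightarrow> ?R")
proof
  assume L: ?L
  show ?R
  proof (intro conjI allI impI)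
    fix U V assume UV: "openin X U \<and> x \<in> U \<and> openin Y V \<and> y \<in> V"
    then have "openin (prod_topology X Y) (U \<times> V)"
      by (simp add: openin_prod_Times_iff)
    then have "\<exists>z. z \<in> S \<and> z \<in> U \<times> V"
      using L[unfolded in_closure_of, THEN conjunct2, rule_format, of "U \<times> V"] UV by simp
    then show "S \<inter> (U \<times> V) \<noteq> {}" by blast
  qed (use L in \<open>auto simp: in_closure_of\<close>)
next
  assume R: ?R
  show ?L
    unfolding in_closure_of
  proof (intro conjI allI impI)
    fix T assume "(x, y) \<in> T \<and> openin (prod_topology X Y) T"
    then obtain U V where UV: "openin X U \<and> x \<in> U \<and> openin Y V \<and> y \<in> V" "U \<times> V \<subseteq> T"
      unfolding openin_prod_topology_alt by metis
    have "S \<inter> (U \<times> V) \<noteq> {}"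
      using R UV(1) by simp
    with UV(2) show "\<exists>z. z \<in> S \<and> z \<in> T" by blast
  qed (use R in auto)
qed

text \<open>A set in the product that accumulates at \<open>x\<close> in the first coordinate may be thinned out to the
  graph of a function \<open>h\<close> over its projection. Since \<open>fst\<close> is injective on the graph, the pieces \<open>F n\<close> induce a
  partition of the projection into finite sets, and the \<open>q\<^sup>+\<close> property of \<open>X\<close> can be used there.\<close>

lemma q_plus_space_selector_above:
  fixes B :: "('a \<times> 'b) set" and F :: "nat \<Rightarrow> ('a \<times> 'b) set"
  assumes "q_plus_space X" and cl: "x \<in> X closure_of (fst ` B)" and "fst ` B \<subseteq> topspace X"
    and "B \<subseteq> (\<Union>n. F n)" and disj: "disjoint_family F" and fin: "\<And>n. finite (F n)"
  obtains T where "T \<subseteq> B" "x \<in> X closure_of (fst ` T)" "\<And>n. card (T \<inter> F n) \<le> 1"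
proof -
  define h where "h = inv_into B fst"
  have h: "h a \<in> B" "fst (h a) = a" if "a \<in> fst ` B" for a
    using that unfolding h_def by (auto intro: inv_into_into f_inv_into_f)
  define G where "G n = {a \<in> fst ` B. h a \<in> F n}" for n
  have "(\<Union>n. G n) = fst ` B"
    using h(1) assms(4) unfolding G_def by blast
  moreover have "disjoint_family G"
    using disj unfolding G_def disjoint_family_on_def by blast
  moreover have "finite (G n)" for n
  proof (rule finite_subset)
    show "G n \<subseteq> fst ` F n" unfolding G_def using h(2) by force
  qed (simp add: fin)
  ultimately have "\<exists>S\<subseteq>fst ` B. x \<in> X closure_of S \<and> (\<forall>n. card (S \<inter> G n) \<le> 1)"
    using assms(1)[unfolded q_plus_space_def, rule_format, of "fst ` B" x G] assms(2,3) by simp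
  then obtain S where S: "S \<subseteq> fst ` B" "x \<in> X closure_of S" "\<And>n. card (S \<inter> G n) \<le> 1"
    by blast
  show ?thesis
  proof
    show "h ` S \<subseteq> B"
      using S(1) h(1) by blast
    have "fst ` h ` S = S"
      using S(1) h(2) by (force simp: image_image)
    with S(2) show "x \<in> X closure_of (fst ` h ` S)" by simp
    fix n
    have "h ` S \<inter> F n = h ` (S \<inter> G n)"
      using S(1) unfolding G_def by blast
    moreover have "finite (S \<inter> G n)"
      using \<open>finite (G n)\<close> by simp
    ultimately show "card (h ` S \<inter> F n) \<le> 1"
      using card_image_le[of "S \<inter> G n" h] S(3)[of n] by simp
  qed
qed

text \<open>If no single point of \<open>A\<close> is a selector, the index set is split along a countable base at \<open>y\<close>, one
  part for each basic neighbourhood, and the selectors found in the parts are united. The union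
  accumulates at \<open>(x, y)\<close> because its \<open>k\<close>-th part lies over \<open>V k\<close>.\<close>

lemma q_plus_space_prod_first_countable:
  fixes X :: "'a topology" and Y :: "'b topology"
  assumes qX: "q_plus_space X" and analytic: "has_analytic_topology X" and fcY: "first_countable Y"
  shows "q_plus_space (prod_topology X Y)"
  unfolding q_plus_space_def
proof (intro allI impI, elim conjE)
  fix A :: "('a \<times> 'b) set" and z :: "'a \<times> 'b" and F :: "nat \<Rightarrow> ('a \<times> 'b) set"
  assume A_sub: "A \<subseteq> topspace (prod_topology X Y)" and z: "z \<in> prod_topology X Y closure_of A"
    and F: "(\<Union>n. F n) = A" "disjoint_family F" and "\<forall>n. finite (F n)"
  then have fin: "finite (F n)" for n by blast
  obtain x y where xy: "z = (x, y)" by (cases z)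
  have cl: "x \<in> topspace X" "y \<in> topspace Y"
    and meet: "\<And>U V. openin X U \<Longrightarrow> x \<in> U \<Longrightarrow> openin Y V \<Longrightarrow> y \<in> V \<Longrightarrow> A \<inter> (U \<times> V) \<noteq> {}"
    using z unfolding xy in_closure_of_prod_topology by blast+
  show "\<exists>S\<subseteq>A. z \<in> prod_topology X Y closure_of S \<and> (\<forall>n. card (S \<inter> F n) \<le> 1)"
  proof (cases "\<exists>p\<in>A. z \<in> prod_topology X Y closure_of {p}")
    case True
    then obtain p where p: "p \<in> A" "z \<in> prod_topology X Y closure_of {p}" by blast
    have "card ({p} \<inter> F n) \<le> 1" for n
      using card_mono[of "{p}" "{p} \<inter> F n"] by simp
    with p show ?thesis by (intro exI[of _ "{p}"]) simp
  next
    case False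
    then have sep: "\<exists>U V. openin X U \<and> x \<in> U \<and> openin Y V \<and> y \<in> V \<and> p \<notin> U \<times> V" if "p \<in> A" for p
    proof -
      have "z \<notin> prod_topology X Y closure_of {p}"
        using False that by blast
      then show ?thesis
        using cl unfolding xy in_closure_of_prod_topology by simp
    qed
    obtain V :: "nat \<Rightarrow> 'b set" where V: "\<And>k. openin Y (V k)" "\<And>k. y \<in> V k"
      "\<And>W. openin Y W \<Longrightarrow> y \<in> W \<Longrightarrow> \<exists>k. V k \<subseteq> W"
      using point_neighbourhood_base_sequence[OF fcY cl(2)] by metis
    \<comment> \<open>The set \<open>\<Union>n\<in>N. G k n\<close> accumulates at \<open>x\<close> if and only if \<open>N\<close> is contained in none of the sets
      \<open>{n. U \<inter> G k n = {}}\<close>.\<close>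
    define G where "G k n = fst ` (F n \<inter> (topspace X \<times> V k))" for k n
    have meager: "meager_family {{n. U \<inter> G k n = {}} |U. openin X U \<and> x \<in> U}" for k
    proof (rule ccontr)
      assume not_meager: "\<not> ?thesis"
      have "meager_family {{n. U \<inter> G k n = {}} |U. openin X U \<and> x \<in> U} \<or>
          (\<exists>U n. openin X U \<and> x \<in> U \<and> (\<forall>m\<ge>n. U \<inter> G k m = {}))"
        by (rule analytic_neighbourhoods_meager_or_cofinite_miss[OF analytic cl(1)])
          (use fin in \<open>auto simp: G_def\<close>)
      with not_meager have "\<exists>U n. openin X U \<and> x \<in> U \<and> (\<forall>m\<ge>n. U \<inter> G k m = {})"
        by argo
      then obtain U n where U: "openin X U" "x \<in> U" "\<And>m. m \<ge> n \<Longrightarrow> U \<inter> G k m = {}"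
        by blast
      \<comment> \<open>Inside \<open>U \<times> V k\<close> the set \<open>A\<close> reduces to the finite set \<open>L\<close>. Each point of \<open>L\<close> is missed by some
        neighbourhood of \<open>(x, y)\<close>, so a finite intersection misses all of \<open>A\<close>.\<close>
      define L where "L = (\<Union>m<n. F m)"
      have "finite L" "L \<subseteq> A"
        using fin F(1) unfolding L_def by auto
      have L: "p \<in> L" if pA: "p \<in> A" and pUV: "p \<in> U \<times> V k" for p
      proof -
        obtain m where m: "p \<in> F m" using pA F(1) by blast
        have "p \<in> topspace X \<times> V k"
          using pUV openin_subset[OF U(1)] by blast
        then have "fst p \<in> U \<inter> G k m"
          using m pUV unfolding G_def by auto
        then have "m < n"
          using U(3)[of m] by (cases "n \<le> m") auto
        with m show ?thesis unfolding L_def by blast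
      qed
      obtain U' V' where UV': "\<And>p. p \<in> L \<Longrightarrow>
          openin X (U' p) \<and> x \<in> U' p \<and> openin Y (V' p) \<and> y \<in> V' p \<and> p \<notin> U' p \<times> V' p"
        using sep \<open>L \<subseteq> A\<close> by (metis subsetD)
      let ?U = "U \<inter> ((\<Inter>p\<in>L. U' p) \<inter> topspace X)" and ?V = "V k \<inter> ((\<Inter>p\<in>L. V' p) \<inter> topspace Y)"
      have "openin X ((\<Inter>p\<in>L. U' p) \<inter> topspace X)" "openin Y ((\<Inter>p\<in>L. V' p) \<inter> topspace Y)"
        by (rule openin_INT; use \<open>finite L\<close> UV' in simp)+
      then have "openin X ?U" "openin Y ?V"
        using U(1) V(1) by (simp_all add: openin_Int)
      moreover have "x \<in> ?U" "y \<in> ?V"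
        using UV' U(2) V(2) cl by simp_all
      ultimately have "A \<inter> (?U \<times> ?V) \<noteq> {}"
        by (intro meet)
      then obtain p where p: "p \<in> A" "p \<in> ?U \<times> ?V"
        by blast
      then have "p \<in> L"
        by (intro L) auto
      then show False
        using UV'[of p] p(2) by (auto simp: mem_Times_iff)
    qed
    define \<E> where "\<E> k = {{n. U \<inter> G k n = {}} |U. openin X U \<and> x \<in> U}" for k
    have "meager_family (\<E> k)" for k
      using meager by (simp add: \<E>_def)
    then obtain N :: "nat \<Rightarrow> nat set"
      where N: "disjoint_family N" "\<And>k E. E \<in> \<E> k \<Longrightarrow> \<not> N k \<subseteq> E"
      using disjoint_sets_escaping_meager_families by metis
    define B where "B k = (\<Union>n\<in>N k. F n \<inter> (topspace X \<times> V k))" for k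
    have "\<exists>T\<subseteq>B k. x \<in> X closure_of (fst ` T) \<and> (\<forall>n. card (T \<inter> F n) \<le> 1)" for k
    proof -
      have "x \<in> X closure_of (fst ` B k)"
        unfolding in_closure_of
      proof (intro conjI allI impI)
        fix U assume "x \<in> U \<and> openin X U"
        then have "\<not> N k \<subseteq> {n. U \<inter> G k n = {}}"
          by (intro N(2)) (auto simp: \<E>_def)
        then show "\<exists>a. a \<in> fst ` B k \<and> a \<in> U"
          unfolding B_def G_def by blast
      qed (fact cl(1))
      moreover have "fst ` B k \<subseteq> topspace X" "B k \<subseteq> (\<Union>n. F n)"
        unfolding B_def by auto
      ultimately show ?thesis
        using q_plus_space_selector_above[OF qX _ _ _ F(2) fin] by metis
    qed
    then obtain T where T: "\<And>k. T k \<subseteq> B k" "\<And>k. x \<in> X closure_of (fst ` T k)"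
      "\<And>k n. card (T k \<inter> F n) \<le> 1"
      by metis
    \<comment> \<open>The selectors for different \<open>k\<close> never use the same piece, so their union is a selector.\<close>
    have index: "n \<in> N k" if pT: "p \<in> T k" and pF: "p \<in> F n" for p k n
    proof -
      obtain m where "m \<in> N k" "p \<in> F m"
        using T(1) pT unfolding B_def by blast
      moreover have "m = n"
        using F(2) \<open>p \<in> F m\<close> pF unfolding disjoint_family_on_def by blast
      ultimately show ?thesis by simp
    qed
    show ?thesis
    proof (intro exI[of _ "\<Union>k. T k"] conjI allI)
      show "(\<Union>k. T k) \<subseteq> A"
        using T(1) F(1) unfolding B_def by blast
      show "z \<in> prod_topology X Y closure_of (\<Union>k. T k)"
        unfolding xy in_closure_of_prod_topology
      proof (intro conjI allI impI)
        fix U W assume UW: "openin X U \<and> x \<in> U \<and> openin Y W \<and> y \<in> W"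
        then obtain k where k: "V k \<subseteq> W" using V(3) by blast
        obtain p where "p \<in> T k" "fst p \<in> U"
          using T(2)[of k] UW unfolding in_closure_of by blast
        moreover have "snd p \<in> W"
        proof -
          have "p \<in> topspace X \<times> V k"
            using \<open>p \<in> T k\<close> T(1)[of k] unfolding B_def by blast
          with k show ?thesis by auto
        qed
        ultimately have "p \<in> U \<times> W"
          using \<open>fst p \<in> U\<close> by (simp add: mem_Times_iff)
        with \<open>p \<in> T k\<close> show "(\<Union>k. T k) \<inter> (U \<times> W) \<noteq> {}"
          by blast
      qed (use cl in auto)
      fix n
      show "card ((\<Union>k. T k) \<inter> F n) \<le> 1"
      proof (cases "\<exists>k. n \<in> N k")
        case True
        then obtain k where k: "n \<in> N k" by blast
        have "j = k" if "n \<in> N j" for j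
          using N(1) k that unfolding disjoint_family_on_def by blast
        then have "(\<Union>k. T k) \<inter> F n = T k \<inter> F n"
          using index by blast
        then show ?thesis using T(3) by simp
      next
        case False
        then have "(\<Union>k. T k) \<inter> F n = {}"
          using index by blast
        then show ?thesis by (metis card.empty zero_le)
      qed
    qed
  qed
qed

theorem theorem3p3:
  fixes X :: "'a topology" and Y :: "'b topology"
  assumes "countable (topspace X)" and "regular_space X" and "q_plus_space X"
    and "has_analytic_topology X"
    and "countable (topspace Y)" and "regular_space Y" and "second_countable Y"
  shows "q_plus_space (prod_topology X Y)"
  using assms by (intro q_plus_space_prod_first_countable second_countable_imp_first_countable)

end
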